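(* Let $(X,T)$ be a $\mathbb{Z}^2$-t.d.s. with metric $d$, let $\mu\in M(X,T)$, and let $\vec{v}=(1,\beta)\in\mathbb{R}^2$ be a direction vector. Then for any $b\in(0,\infty)$ the following two statements are equivalent: (a) $(X,T)$ has bounded topological complexity with respect to $\{d_k^{\vec{v},b}\}_{k=1}^\infty$; (b) $(X,T)$ is $(\vec{v},b)$-equicontinuous. Likewise, for any $b\in(0,\infty)$ the following two statements are equivalent: (a') $(X,T)$ has bounded topological complexity with respect to $\{\hat{d}_k^{\vec{v},b}\}_{k=1}^\infty$; (b') $(X,T)$ is $(\vec{v},b)$-equicontinuous in the mean.
   Context: A $\mathbb{Z}^2$-t.d.s. $(X,T)$ is a compact metric space $(X,d)$ with a group homomorphism $\vec{w}\mapsto T^{\vec{w}}$ from $\mathbb{Z}^2$ to the group of homeomorphisms of $X$. $M(X,T)$ is the set of Borel probability measures $\mu$ on $X$ with $\mu(T^{-\vec{w}}A)=\mu(A)$ for all $\vec{w}\in\mathbb{Z}^2$ and Borel $A$. For $b>0$ let $\Lambda^{\vec{v}}(b)=\{(m,n)\in\mathbb{Z}^2:\beta m-b\le n\le\beta m+b\}$ and, for $k\in\mathbb{N}=\{1,2,\dots\}$, $\Lambda_k^{\vec{v}}(b)=\Lambda^{\vec{v}}(b)\cap(\{0,1,\dots,k-1\}\times\mathbb{Z})$. For $x,y\in X$ define $$d_k^{\vec{v},b}(x,y)=\max_{(m,n)\in\Lambda_k^{\vec{v}}(b)}d(T^{(m,n)}x,T^{(m,n)}y),$$ $$\hat{d}_k^{\vec{v},b}(x,y)=\max_{1\le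 i\le k}\frac{1}{\#(\Lambda_i^{\vec{v}}(b))}\sum_{(m,n)\in\Lambda_i^{\vec{v}}(b)}d(T^{(m,n)}x,T^{(m,n)}y),$$ where $\#(A)$ is the cardinality of a finite set $A$. For a sequence $\{\rho_k\}$ of metrics on $X$ write $B_{\rho_k}(x,\epsilon)=\{y\in X:\rho_k(x,y)<\epsilon\}$. $(X,T)$ has bounded topological complexity with respect to $\{\rho_k\}$ if for every $\epsilon>0$ there is a positive integer $C=C(\epsilon)$ such that for each $k\in\mathbb{N}$ there are $x_1,\dots,x_m\in X$ with $m\le C$ and $X=\bigcup_{i=1}^m B_{\rho_k}(x_i,\epsilon)$. $(X,T)$ is $(\vec{v},b)$-equicontinuous if for every $\epsilon>0$ there is $\delta>0$ such that for all $x,y\in X$ with $d(x,y)<\delta$, $d(T^{(m,n)}x,T^{(m,n)}y)<\epsilon$ for all $(m,n)\in\Lambda^{\vec{v}}(b)$. $(X,T)$ is $(\vec{v},b)$-equicontinuous in the mean if for every $\epsilon>0$ there is $\delta>0$ such that $\hat{d}_k^{\vec{v},b}(x,y)<\epsilon$ for all $k\in\mathbb{N}$ and all $x,y\in X$ with $d(x,y)<\delta$. *)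

theory Defs
  imports "HOL-Probability.Probability"
begin

text \<open>
  The compact metric space is the carrier of a type of class \<open>metric_space\<close> and
  \<open>d\<close> is \<^const>\<open>dist\<close>. The group homomorphism law forces \<open>T 0 = id\<close>, because each
  \<open>T w\<close> is bijective.
\<close>

definition Z2_tds :: "(int \<times> int \<Rightarrow> 'a::metric_space \<Rightarrow> 'a) \<Rightarrow> bool" where
  "Z2_tds T \<longleftrightarrow>
     compact (UNIV :: 'a set) \<and>
     (\<forall>w. \<exists>S. homeomorphism UNIV UNIV (T w) S) \<and>
     (\<forall>u w. T (u + w) = T u \<circ> T w)"

definition invariant_measures ::
    "(int \<times> int \<Rightarrow> 'a::metric_space \<Rightarrow> 'a) \<Rightarrow> 'a measure set" where
  "invariant_measures T =
     {\<mu>. prob_space \<mu> \<and> sets \<mu> = sets borel \<and>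
         (\<forall>w. \<forall>A\<in>sets borel. emeasure \<mu> (T (- w) ` A) = emeasure \<mu> A)}"

text \<open>
  The direction vector \<open>(1, \<beta>)\<close> is represented by its slope \<open>\<beta>\<close>.
\<close>

definition strip :: "real \<Rightarrow> real \<Rightarrow> (int \<times> int) set" where
  "strip \<beta> b =
     {(m, n). \<beta> * real_of_int m - b \<le> real_of_int n \<and> real_of_int n \<le> \<beta> * real_of_int m + b}"

definition strip_upto :: "real \<Rightarrow> real \<Rightarrow> nat \<Rightarrow> (int \<times> int) set" where
  "strip_upto \<beta> b k = strip \<beta> b \<inter> ({0..<int k} \<times> UNIV)"

text \<open>
  The next two facts ensure that the maxima, sums and cardinalities below are those of
  finite nonempty sets.
\<close>

lemma finite_strip_upto: "finite (strip_upto \<beta> b k)"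
proof (rule finite_subset)
  show "strip_upto \<beta> b k \<subseteq>
      (SIGMA m:{0..<int k}. {\<lceil>\<beta> * real_of_int m - b\<rceil>..\<lfloor>\<beta> * real_of_int m + b\<rfloor>})"
    by (auto simp: strip_upto_def strip_def ceiling_le_iff le_floor_iff)
qed auto

lemma zero_in_strip_upto: "b \<ge> 0 \<Longrightarrow> k \<ge> 1 \<Longrightarrow> (0, 0) \<in> strip_upto \<beta> b k"
  by (simp add: strip_upto_def strip_def)

definition max_metric ::
    "(int \<times> int \<Rightarrow> 'a::metric_space \<Rightarrow> 'a) \<Rightarrow> real \<Rightarrow> real \<Rightarrow> nat \<Rightarrow> 'a \<Rightarrow> 'a \<Rightarrow> real" where
  "max_metric T \<beta> b k x y = Max ((\<lambda>w. dist (T w x) (T w y)) ` strip_upto \<beta> b k)"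

definition mean_metric ::
    "(int \<times> int \<Rightarrow> 'a::metric_space \<Rightarrow> 'a) \<Rightarrow> real \<Rightarrow> real \<Rightarrow> nat \<Rightarrow> 'a \<Rightarrow> 'a \<Rightarrow> real" where
  "mean_metric T \<beta> b k x y =
     Max ((\<lambda>i. (1 / real (card (strip_upto \<beta> b i))) *
                (\<Sum>w\<in>strip_upto \<beta> b i. dist (T w x) (T w y))) ` {1..k})"

text \<open>
  Sequences of metrics are indexed from 1; the value at index 0 is irrelevant.
\<close>

definition bounded_topological_complexity :: "(nat \<Rightarrow> 'a \<Rightarrow> 'a \<Rightarrow> real) \<Rightarrow> bool" where
  "bounded_topological_complexity \<rho> \<longleftrightarrow>
     (\<forall>\<epsilon>>0. \<exists>C::nat. C > 0 \<and>
        (\<forall>k\<ge>1. \<exists>m (x :: nat \<Rightarrow> 'a). m \<le> C \<and>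
            UNIV = (\<Union>i\<in>{1..m}. {y. \<rho> k (x i) y < \<epsilon>})))"

definition directional_equicontinuous ::
    "(int \<times> int \<Rightarrow> 'a::metric_space \<Rightarrow> 'a) \<Rightarrow> real \<Rightarrow> real \<Rightarrow> bool" where
  "directional_equicontinuous T \<beta> b \<longleftrightarrow>
     (\<forall>\<epsilon>>0. \<exists>\<delta>>0. \<forall>x y. dist x y < \<delta> \<longrightarrow>
        (\<forall>w\<in>strip \<beta> b. dist (T w x) (T w y) < \<epsilon>))"

definition directional_equicontinuous_in_mean ::
    "(int \<times> int \<Rightarrow> 'a::metric_space \<Rightarrow> 'a) \<Rightarrow> real \<Rightarrow> real \<Rightarrow> bool" where
  "directional_equicontinuous_in_mean T \<beta> b \<longleftrightarrow>
     (\<forall>\<epsilon>>0. \<exists>\<delta>>0. \<forall>k\<ge>1. \<forall>x y. dist x y < \<delta> \<longrightarrow> mean_metric T \<beta> b k x y < \<epsilon>)"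

end

theory Submission
  imports Defs
begin

text \<open>
  Both complexities are taken with respect to an increasing sequence of maxima of continuous
  pseudometrics. If the complexity is bounded, a separated set of largest possible cardinality
  yields a finite cover of the space by closed balls that are uniform in \<open>k\<close>. Two points outside
  all the members that miss \<open>x\<close> lie in members containing \<open>x\<close>, and a Lebesgue number
  turns this into uniform equicontinuity. This settles the mean case, and gives equicontinuity
  along the half strip \<open>m \<ge> 0\<close> in the other one. Equicontinuity along a half strip does not depend
  on its width, and by pigeonhole some \<open>T\<^sup>u\<close> with \<open>u\<close> far out is uniformly close to the identity; so
  \<open>T\<^sup>-\<^sup>w = T\<^sup>u\<^sup>-\<^sup>w \<circ> T\<^sup>-\<^sup>u\<close> is controlled by the forward half strip.
\<close>

section \<open>Bounded complexity of maxima of pseudometrics\<close>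

text \<open>Pigeonhole: two points of \<open>S\<close> in the same ball of the cover would be at
  \<open>\<rho>\<close>-distance less than \<open>2 * \<epsilon>\<close>, so each ball holds at most
  one.\<close>

lemma card_separated_le:
  fixes \<rho> :: "'a \<Rightarrow> 'a \<Rightarrow> real"
  assumes sym: "\<And>x y. \<rho> x y = \<rho> y x"
    and tri: "\<And>x y z. \<rho> x z \<le> \<rho> x y + \<rho> y z"
    and cover: "UNIV = (\<Union>i\<in>{1..m::nat}. {y. \<rho> (c i) y < \<epsilon>})"
    and sep: "\<And>s t. s \<in> S \<Longrightarrow> t \<in> S \<Longrightarrow> s \<noteq> t \<Longrightarrow> 2 * \<epsilon> \<le> \<rho> s t"
  shows "card S \<le> m"
proof -
  have "\<forall>y. \<exists>i. i \<in> {1..m} \<and> \<rho> (c i) y < \<epsilon>"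
    using cover by blast
  then obtain g where g: "\<And>y. g y \<in> {1..m}" "\<And>y. \<rho> (c (g y)) y < \<epsilon>"
    by metis
  have "inj_on g S"
  proof (rule inj_onI, rule ccontr)
    fix s t assume st: "s \<in> S" "t \<in> S" "g s = g t" "s \<noteq> t"
    have "\<rho> s t \<le> \<rho> (c (g s)) s + \<rho> (c (g t)) t"
      using tri[of s t "c (g s)"] sym[of s "c (g s)"] st(3) by simp
    then show False
      using g(2)[of s] g(2)[of t] sep[OF st(1,2,4)] by simp
  qed
  then have "card S \<le> card {1..m}"
    using g(1) by (intro card_inj_on_le) auto
  then show ?thesis by simp
qed

text \<open>An \<open>\<epsilon>\<close>-separated set that is largest over all indices together
  stays separated when \<open>k\<close> grows, by monotonicity, hence stays maximal and so remains a
  net. The point near \<open>y\<close> may still vary with \<open>k\<close>; finiteness of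
  \<open>S\<close> removes this dependence.\<close>

lemma bounded_complexity_imp_uniform_net:
  fixes \<rho> :: "nat \<Rightarrow> 'a \<Rightarrow> 'a \<Rightarrow> real"
  assumes btc: "bounded_topological_complexity \<rho>"
    and self: "\<And>k x. 1 \<le> k \<Longrightarrow> \<rho> k x x = 0"
    and sym: "\<And>k x y. 1 \<le> k \<Longrightarrow> \<rho> k x y = \<rho> k y x"
    and tri: "\<And>k x y z. 1 \<le> k \<Longrightarrow> \<rho> k x z \<le> \<rho> k x y + \<rho> k y z"
    and mono: "\<And>k l x y. 1 \<le> k \<Longrightarrow> k \<le> l \<Longrightarrow> \<rho> k x y \<le> \<rho> l x y"
    and "\<epsilon> > 0"
  obtains S where "finite S" "\<And>y. \<exists>s\<in>S. \<forall>k\<ge>1. \<rho> k s y \<le> \<epsilon>"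
proof -
  define sep where "sep k S \<longleftrightarrow> finite S \<and> (\<forall>s\<in>S. \<forall>t\<in>S. s \<noteq> t \<longrightarrow> \<epsilon> \<le> \<rho> k s t)" for k S
  \<comment> \<open>Radius \<open>\<epsilon> / 2\<close> makes the factor 2 in
    \<open>card_separated_le\<close> match separation by \<open>\<epsilon>\<close>.\<close>
  obtain C where C: "\<And>k. 1 \<le> k \<Longrightarrow> \<exists>m c. m \<le> C \<and>
      UNIV = (\<Union>i\<in>{1..m::nat}. {y. \<rho> k (c i) y < \<epsilon> / 2})"
    using btc \<open>\<epsilon> > 0\<close> unfolding bounded_topological_complexity_def
    by (meson half_gt_zero)
  have bound: "card S \<le> C" if k: "1 \<le> k" and S: "sep k S" for k S
  proof -
    obtain m c where "m \<le> C" and cov: "UNIV = (\<Union>i\<in>{1..m::nat}. {y. \<rho> k (c i) y < \<epsilon> / 2})"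
      using C[OF k] by blast
    have "card S \<le> m"
      using S by (intro card_separated_le[OF sym[OF k] tri[OF k] cov]) (auto simp: sep_def)
    with \<open>m \<le> C\<close> show ?thesis by simp
  qed
  \<comment> \<open>The index \<open>k\<close> is quantified inside \<open>Q\<close>, so
    \<open>Greatest Q\<close> is a maximum over all the pseudometrics at once; it is attained at
    some \<open>k0\<close>.\<close>
  define Q where "Q n \<longleftrightarrow> (\<exists>k\<ge>1. \<exists>S. sep k S \<and> card S = n)" for n
  have "Q 0" unfolding Q_def sep_def by (intro exI[of _ 1] conjI exI[of _ "{}"]) auto
  have Q_le: "n \<le> C" if "Q n" for n
    using bound that unfolding Q_def by blast
  have max: "n \<le> Greatest Q" if "Q n" for n
    using that Q_le by (rule Greatest_le_nat)
  have "Q (Greatest Q)"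
    using \<open>Q 0\<close> Q_le by (rule GreatestI_nat)
  then obtain k0 S where k0: "1 \<le> k0" and S: "sep k0 S" and card: "card S = Greatest Q"
    unfolding Q_def by blast
  have fin: "finite S" using S by (simp add: sep_def)
  \<comment> \<open>A point far from \<open>S\<close> at a stage \<open>k\<close> beyond
    \<open>k0\<close> could be added to \<open>S\<close>, giving a separated set larger than the
    maximum.\<close>
  have near: "\<exists>s\<in>S. \<rho> k s y < \<epsilon>" if "k0 \<le> k" for k y
  proof (rule ccontr)
    assume "\<not> (\<exists>s\<in>S. \<rho> k s y < \<epsilon>)"
    then have far: "\<And>s. s \<in> S \<Longrightarrow> \<epsilon> \<le> \<rho> k s y" by force
    have k: "1 \<le> k" using k0 that by simp
    have "y \<notin> S" using far[of y] self[OF k, of y] \<open>\<epsilon> > 0\<close> by auto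
    have "\<epsilon> \<le> \<rho> k s t" if "s \<in> S" "t \<in> S" "s \<noteq> t" for s t
      using S mono[OF k0 \<open>k0 \<le> k\<close>, of s t] that unfolding sep_def by force
    moreover have "\<epsilon> \<le> \<rho> k y s" if "s \<in> S" for s
      using far[OF that] sym[OF k, of y s] by simp
    ultimately have "sep k (insert y S)"
      using far fin unfolding sep_def by blast
    then have "Q (Suc (card S))"
      unfolding Q_def using k \<open>y \<notin> S\<close> fin
      by (intro exI[of _ k] conjI exI[of _ "insert y S"]) auto
    then show False using max card by fastforce
  qed
  have "\<exists>s\<in>S. \<forall>k\<ge>1. \<rho> k s y \<le> \<epsilon>" for y
  proof (rule ccontr)
    assume "\<not> ?thesis"
    then have "\<forall>s\<in>S. \<exists>l. 1 \<le> l \<and> \<rho> l s y > \<epsilon>"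
      by (auto simp: not_le)
    from bchoice[OF this] obtain K where K: "\<And>s. s \<in> S \<Longrightarrow> 1 \<le> K s \<and> \<rho> (K s) s y > \<epsilon>"
      by blast
    \<comment> \<open>If each \<open>s\<close> fails at its own stage \<open>K s\<close>, then by
      monotonicity all of them fail at this common later stage, against \<open>near\<close>.\<close>
    define k where "k = Max (insert k0 (K ` S))"
    have "k0 \<le> k" unfolding k_def using fin by (intro Max_ge) auto
    obtain s where s: "s \<in> S" "\<rho> k s y < \<epsilon>"
      using near[OF \<open>k0 \<le> k\<close>] by blast
    have "K s \<le> k" unfolding k_def using s fin by (intro Max_ge) auto
    then show False using mono[of "K s" k s y] K[OF s(1)] s(2) by simp
  qed
  then show thesis using that fin by blast
qed

text \<open>The closed sets \<open>F s\<close> form a finite cover, so removing from the space those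
  that miss \<open>x\<close> leaves an open neighbourhood \<open>U x\<close>, and every point of it
  shares some \<open>F s\<close> with \<open>x\<close>.\<close>

lemma uniform_net_imp_equicontinuous:
  fixes \<rho> :: "nat \<Rightarrow> 'a::metric_space \<Rightarrow> 'a \<Rightarrow> real"
  assumes comp: "compact (UNIV :: 'a set)"
    and sym: "\<And>k x y. 1 \<le> k \<Longrightarrow> \<rho> k x y = \<rho> k y x"
    and tri: "\<And>k x y z. 1 \<le> k \<Longrightarrow> \<rho> k x z \<le> \<rho> k x y + \<rho> k y z"
    and clos: "\<And>k x e. 1 \<le> k \<Longrightarrow> closed {y. \<rho> k x y \<le> e}"
    and fin: "finite S" and net: "\<And>y. \<exists>s\<in>S. \<forall>k\<ge>1. \<rho> k s y \<le> \<epsilon>"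
  shows "\<exists>\<delta>>0. \<forall>x y. dist x y < \<delta> \<longrightarrow> (\<forall>k\<ge>1. \<rho> k x y \<le> 4 * \<epsilon>)"
proof -
  define F where "F s = {y. \<forall>k\<in>{1..}. \<rho> k s y \<le> \<epsilon>}" for s
  have "F s = (\<Inter>k\<in>{1..}. {y. \<rho> k s y \<le> \<epsilon>})" for s
    by (auto simp: F_def)
  then have "closed (F s)" for s
    using clos by auto
  define U where "U x = - (\<Union>s\<in>{s\<in>S. x \<notin> F s}. F s)" for x
  have opn: "open (U x)" for x
    using fin \<open>\<And>s. closed (F s)\<close> unfolding U_def by (intro open_Compl closed_UN) auto
  have "x \<in> U x" for x by (auto simp: U_def)
  then have "UNIV \<subseteq> \<Union>(range U)" by blast
  then obtain \<delta> where "\<delta> > 0" and \<delta>: "\<And>x. \<exists>G\<in>range U. ball x \<delta> \<subseteq> G"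
    by (rule Heine_Borel_lemma[OF comp]) (use opn in auto)
  have meet: "\<exists>s\<in>S. x \<in> F s \<and> y \<in> F s" if "y \<in> U x" for x y
    using net[of y] that by (auto simp: U_def F_def)
  have "\<rho> k x y \<le> 4 * \<epsilon>" if xy: "dist x y < \<delta>" and k: "1 \<le> k" for x y k
  proof -
    \<comment> \<open>The Lebesgue ball lies in \<open>U z\<close> for a \<open>z\<close> that may
      differ from \<open>x\<close>. The chain from \<open>x\<close> via \<open>s\<close>,
      \<open>z\<close>, \<open>t\<close> to \<open>y\<close> has four links, whence the factor
      4.\<close>
    obtain z where z: "ball x \<delta> \<subseteq> U z" using \<delta> by blast
    then have "x \<in> U z" "y \<in> U z" using xy \<open>\<delta> > 0\<close> by auto
    then obtain s t where "z \<in> F s" "x \<in> F s" "z \<in> F t" "y \<in> F t"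
      using meet by meson
    then have "\<rho> k s z \<le> \<epsilon>" "\<rho> k s x \<le> \<epsilon>" "\<rho> k t z \<le> \<epsilon>" "\<rho> k t y \<le> \<epsilon>"
      using k by (auto simp: F_def)
    then show ?thesis
      using tri[OF k, of x y z] tri[OF k, of x z s] tri[OF k, of z y t] sym[OF k, of x s]
        sym[OF k, of z t] by linarith
  qed
  then show ?thesis using \<open>\<delta> > 0\<close> by blast
qed

lemma compact_UNIV_finite_net:
  assumes "compact (UNIV :: 'a::metric_space set)" "\<delta> > 0"
  obtains D :: "'a::metric_space set" where "finite D" "\<And>x. \<exists>p\<in>D. dist p x < \<delta>"
proof -
  obtain D :: "'a set" where "finite D" "UNIV \<subseteq> (\<Union>p\<in>D. ball p \<delta>)"
    using seq_compact_imp_totally_bounded[of UNIV] assms compact_imp_seq_compact by blast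
  have "\<exists>p\<in>D. dist p x < \<delta>" for x
    using subsetD[OF \<open>UNIV \<subseteq> _\<close> UNIV_I, of x] by simp
  with \<open>finite D\<close> show thesis by (rule that)
qed

text \<open>A single finite \<open>\<delta>\<close>-net for \<open>dist\<close> supplies the centres
  for every \<open>k\<close>.\<close>

lemma equicontinuous_imp_bounded_complexity:
  fixes \<rho> :: "nat \<Rightarrow> 'a::metric_space \<Rightarrow> 'a \<Rightarrow> real"
  assumes comp: "compact (UNIV :: 'a set)"
    and equi: "\<And>\<epsilon>. \<epsilon> > 0 \<Longrightarrow> \<exists>\<delta>>0. \<forall>x y. dist x y < \<delta> \<longrightarrow> (\<forall>k\<ge>1. \<rho> k x y < \<epsilon>)"
  shows "bounded_topological_complexity \<rho>"
  unfolding bounded_topological_complexity_def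
proof (intro allI impI)
  fix \<epsilon> :: real assume "\<epsilon> > 0"
  then obtain \<delta> where "\<delta> > 0" and \<delta>: "\<And>x y k. dist x y < \<delta> \<Longrightarrow> 1 \<le> k \<Longrightarrow> \<rho> k x y < \<epsilon>"
    using equi by metis
  obtain D :: "'a set" where D: "finite D" "\<And>x. \<exists>p\<in>D. dist p x < \<delta>"
    using compact_UNIV_finite_net[OF comp \<open>\<delta> > 0\<close>] by blast
  obtain h where h: "bij_betw h {1..card D} D"
    using ex_bij_betw_nat_finite_1[OF D(1)] by blast
  have "card D > 0" using D by (auto simp: card_gt_0_iff)
  moreover have "UNIV = (\<Union>i\<in>{1..card D}. {y. \<rho> k (h i) y < \<epsilon>})" if "k \<ge> 1" for k
  proof -
    have "\<exists>i\<in>{1..card D}. \<rho> k (h i) y < \<epsilon>" for y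
      using D(2)[of y] \<delta>[OF _ that] h by (metis bij_betw_imp_surj_on image_iff)
    then show ?thesis by blast
  qed
  ultimately show "\<exists>C::nat. C > 0 \<and> (\<forall>k\<ge>1. \<exists>m x. m \<le> C \<and> UNIV = (\<Union>i\<in>{1..m}. {y. \<rho> k (x i) y < \<epsilon>}))"
    by blast
qed

text \<open>Serves both sequences of metrics: \<open>\<sigma>\<close> is a distance along one group
  element for \<open>max_metric\<close>, and an average over one initial strip for
  \<open>mean_metric\<close>. Index 0 is excluded because \<open>I 0\<close> is empty in both cases
  and \<open>Max\<close> of the empty set is unspecified.\<close>

lemma bounded_complexity_Max_iff:
  fixes \<sigma> :: "'i \<Rightarrow> 'a::metric_space \<Rightarrow> 'a \<Rightarrow> real"
  assumes comp: "compact (UNIV :: 'a set)"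
    and \<rho>: "\<And>k x y. \<rho> k x y = Max ((\<lambda>i. \<sigma> i x y) ` I k)"
    and fin: "\<And>k. 1 \<le> k \<Longrightarrow> finite (I k)" and ne: "\<And>k. 1 \<le> k \<Longrightarrow> I k \<noteq> {}"
    and mono: "\<And>k l. k \<le> l \<Longrightarrow> I k \<subseteq> I l"
    and self: "\<And>i x. \<sigma> i x x = 0"
    and sym: "\<And>i x y. \<sigma> i x y = \<sigma> i y x"
    and tri: "\<And>i x y z. \<sigma> i x z \<le> \<sigma> i x y + \<sigma> i y z"
    and cont: "\<And>i x. continuous_on UNIV (\<sigma> i x)"
  shows "bounded_topological_complexity \<rho> \<longleftrightarrow>
    (\<forall>\<epsilon>>0. \<exists>\<delta>>0. \<forall>x y. dist x y < \<delta> \<longrightarrow> (\<forall>k\<ge>1. \<rho> k x y < \<epsilon>))"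
proof
  assume btc: "bounded_topological_complexity \<rho>"
  have le_iff: "\<rho> k x y \<le> e \<longleftrightarrow> (\<forall>i\<in>I k. \<sigma> i x y \<le> e)" if "1 \<le> k" for k x y e
    using fin[OF that] ne[OF that] by (simp add: \<rho>)
  have le: "\<sigma> i x y \<le> \<rho> k x y" if "1 \<le> k" "i \<in> I k" for i k x y
    using le_iff[OF that(1), of x y "\<rho> k x y"] that(2) by simp
  have self': "\<rho> k x x = 0" if "1 \<le> k" for k x
    using ne[OF that] by (simp add: \<rho> self image_constant_conv)
  have sym': "\<rho> k x y = \<rho> k y x" for k x y
    unfolding \<rho> by (subst sym) (rule refl)
  have tri': "\<rho> k x z \<le> \<rho> k x y + \<rho> k y z" if "1 \<le> k" for k x y z
    unfolding le_iff[OF that] using tri le[OF that] by (meson add_mono order_trans)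
  have mono': "\<rho> k x y \<le> \<rho> l x y" if "1 \<le> k" "k \<le> l" for k l x y
    unfolding le_iff[OF that(1)] using mono[OF that(2)] le[of l] that by auto
  have clos: "closed {y. \<rho> k x y \<le> e}" if "1 \<le> k" for k x e
  proof -
    have "{y. \<rho> k x y \<le> e} = (\<Inter>i\<in>I k. {y. \<sigma> i x y \<le> e})"
      using le_iff[OF that] by auto
    moreover have "closed {y. \<sigma> i x y \<le> e}" for i
      using cont by (intro closed_Collect_le) auto
    ultimately show ?thesis by auto
  qed
  show "\<forall>\<epsilon>>0. \<exists>\<delta>>0. \<forall>x y. dist x y < \<delta> \<longrightarrow> (\<forall>k\<ge>1. \<rho> k x y < \<epsilon>)"
  proof (intro allI impI)
    fix \<epsilon> :: real assume "\<epsilon> > 0"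
    \<comment> \<open>Four links of length at most \<open>\<epsilon> / 5\<close> leave room for a
      strict bound by \<open>\<epsilon>\<close>.\<close>
    then have "\<epsilon> / 5 > 0" by simp
    obtain S where "finite S" and net: "\<And>y. \<exists>s\<in>S. \<forall>k\<ge>1. \<rho> k s y \<le> \<epsilon> / 5"
      using bounded_complexity_imp_uniform_net[OF btc self' sym' tri' mono' \<open>\<epsilon> / 5 > 0\<close>] by blast
    obtain \<delta> where "\<delta> > 0" "\<And>x y k. dist x y < \<delta> \<Longrightarrow> 1 \<le> k \<Longrightarrow> \<rho> k x y \<le> 4 * (\<epsilon> / 5)"
      using uniform_net_imp_equicontinuous[OF comp sym' tri' clos \<open>finite S\<close> net] by blast
    moreover have "4 * (\<epsilon> / 5) < \<epsilon>" using \<open>\<epsilon> > 0\<close> by simp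
    ultimately show "\<exists>\<delta>>0. \<forall>x y. dist x y < \<delta> \<longrightarrow> (\<forall>k\<ge>1. \<rho> k x y < \<epsilon>)"
      by (meson le_less_trans)
  qed
qed (use equicontinuous_imp_bounded_complexity[OF comp] in blast)

section \<open>Equicontinuity along subsets of the acting group\<close>

text \<open>Arbitrary index sets allow the strip to be cut, translated and negated piece by
  piece.\<close>

definition equicontinuous_along ::
    "(int \<times> int \<Rightarrow> 'a::metric_space \<Rightarrow> 'a) \<Rightarrow> (int \<times> int) set \<Rightarrow> bool" where
  "equicontinuous_along T W \<longleftrightarrow>
     (\<forall>\<epsilon>>0. \<exists>\<delta>>0. \<forall>x y. dist x y < \<delta> \<longrightarrow> (\<forall>w\<in>W. dist (T w x) (T w y) < \<epsilon>))"

definition half_strip :: "real \<Rightarrow> real \<Rightarrow> (int \<times> int) set" where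
  "half_strip \<beta> b = strip \<beta> b \<inter> ({0..} \<times> UNIV)"

lemma Z2_tds_add: "Z2_tds T \<Longrightarrow> T (u + w) x = T u (T w x)"
  unfolding Z2_tds_def by (metis comp_apply)

lemma Z2_tds_continuous: "Z2_tds T \<Longrightarrow> continuous_on UNIV (T w)"
  by (meson Z2_tds_def homeomorphism_cont1)

text \<open>\<open>T 0\<close> is idempotent and has a left inverse.\<close>

lemma Z2_tds_zero:
  assumes "Z2_tds T"
  shows "T 0 x = x"
proof -
  obtain S where "homeomorphism UNIV UNIV (T 0) S"
    using assms unfolding Z2_tds_def by blast
  then have "S (T 0 y) = y" for y by (simp add: homeomorphism_def)
  then show ?thesis
    using Z2_tds_add[OF assms, of 0 0 x] by (metis add_0)
qed

lemma equicontinuous_along_subset: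
  "equicontinuous_along T W \<Longrightarrow> V \<subseteq> W \<Longrightarrow> equicontinuous_along T V"
  unfolding equicontinuous_along_def by (meson subsetD)

lemma equicontinuous_along_Un:
  assumes "equicontinuous_along T V" "equicontinuous_along T W"
  shows "equicontinuous_along T (V \<union> W)"
  unfolding equicontinuous_along_def
proof (intro allI impI)
  fix \<epsilon> :: real assume "\<epsilon> > 0"
  then obtain d e where "d > 0" "e > 0"
    "\<And>x y w. dist x y < d \<Longrightarrow> w \<in> V \<Longrightarrow> dist (T w x) (T w y) < \<epsilon>"
    "\<And>x y w. dist x y < e \<Longrightarrow> w \<in> W \<Longrightarrow> dist (T w x) (T w y) < \<epsilon>"
    using assms unfolding equicontinuous_along_def by metis
  then show "\<exists>\<delta>>0. \<forall>x y. dist x y < \<delta> \<longrightarrow> (\<forall>w\<in>V \<union> W. dist (T w x) (T w y) < \<epsilon>)"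
    by (intro exI[of _ "min d e"]) auto
qed

lemma equicontinuous_along_finite:
  fixes T :: "int \<times> int \<Rightarrow> 'a::metric_space \<Rightarrow> 'a"
  assumes T: "Z2_tds T" and "finite W"
  shows "equicontinuous_along T W"
  using \<open>finite W\<close>
proof induction
  case empty
  show ?case by (auto simp: equicontinuous_along_def intro: exI[of _ 1])
next
  case (insert w W)
  have "compact (UNIV :: 'a set)" using T by (simp add: Z2_tds_def)
  then have "uniformly_continuous_on UNIV (T w)"
    using compact_uniformly_continuous Z2_tds_continuous[OF T] by blast
  then have "equicontinuous_along T {w}"
    unfolding equicontinuous_along_def uniformly_continuous_on_def by (simp add: dist_commute)
  then show ?case
    using equicontinuous_along_Un[OF _ insert.IH] by (metis insert_is_Un)
qed

lemma equicontinuous_along_sum: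
  assumes T: "Z2_tds T" and "equicontinuous_along T V" "equicontinuous_along T W"
  shows "equicontinuous_along T {v + w | v w. v \<in> V \<and> w \<in> W}"
  unfolding equicontinuous_along_def
proof (intro allI impI)
  fix \<epsilon> :: real assume "\<epsilon> > 0"
  then obtain e where "e > 0"
    and e: "\<And>x y w. dist x y < e \<Longrightarrow> w \<in> V \<Longrightarrow> dist (T w x) (T w y) < \<epsilon>"
    using assms unfolding equicontinuous_along_def by metis
  moreover obtain d where "d > 0"
    and "\<And>x y w. dist x y < d \<Longrightarrow> w \<in> W \<Longrightarrow> dist (T w x) (T w y) < e"
    using assms \<open>e > 0\<close> unfolding equicontinuous_along_def by metis
  ultimately show "\<exists>\<delta>>0. \<forall>x y. dist x y < \<delta> \<longrightarrow>
      (\<forall>w\<in>{v + w | v w. v \<in> V \<and> w \<in> W}. dist (T w x) (T w y) < \<epsilon>)"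
    using Z2_tds_add[OF T] by (intro exI[of _ d]) auto
qed

section \<open>Half strips\<close>

text \<open>
  Sort the wide half strip by the offset \<open>n - \<beta> m\<close> into finitely many classes of width \<open>b\<close>.
  Subtracting an element with least \<open>m\<close> from its whole class lands in the narrow half strip.
\<close>

lemma half_strip_cover:
  assumes "b > 0"
  obtains F where "finite F" "half_strip \<beta> B \<subseteq> {v + w | v w. v \<in> F \<and> w \<in> half_strip \<beta> b}"
proof -
  define cls where "cls w = \<lfloor>(of_int (snd w) - \<beta> * of_int (fst w)) / b\<rfloor>" for w
  \<comment> \<open>The value is arbitrary for an empty class, but it is only used at classes
    \<open>cls u\<close> that contain \<open>u\<close>. Taking \<open>nat\<close> loses nothing, as
    first coordinates are nonnegative here.\<close>
  define least where
    "least c = (ARG_MIN (\<lambda>w. nat (fst w)) w. w \<in> half_strip \<beta> B \<and> cls w = c)" for c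
  define J where "J = {\<lfloor>- B / b\<rfloor>..\<lfloor>B / b\<rfloor>}"
  have "u \<in> {v + w | v w. v \<in> least ` J \<and> w \<in> half_strip \<beta> b}" if u: "u \<in> half_strip \<beta> B" for u
  proof -
    define v where "v = least (cls u)"
    have v: "v \<in> half_strip \<beta> B \<and> cls v = cls u"
      unfolding v_def least_def
      by (rule arg_min_natI[where P = "\<lambda>w. w \<in> half_strip \<beta> B \<and> cls w = cls u"]) (use u in simp)
    have "nat (fst v) \<le> nat (fst u)"
      unfolding v_def least_def
      by (rule arg_min_nat_le[where P = "\<lambda>w. w \<in> half_strip \<beta> B \<and> cls w = cls u"]) (use u in simp)
    moreover have "0 \<le> fst u" using u by (auto simp: half_strip_def)
    ultimately have "fst v \<le> fst u" by simp
    define p q where "p = (of_int (snd u) - \<beta> * of_int (fst u)) / b"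
      and "q = (of_int (snd v) - \<beta> * of_int (fst v)) / b"
    have "- B / b \<le> p" "p \<le> B / b"
      unfolding p_def using u \<open>b > 0\<close>
      by (auto simp: half_strip_def strip_def simp del: divide_minus_left
          intro!: divide_right_mono)
    then have "cls u \<in> J"
      unfolding J_def cls_def p_def[symmetric] by (auto intro: floor_mono)
    \<comment> \<open>\<open>p\<close> and \<open>q\<close> have the same floor. Scaling back by
      \<open>b\<close> bounds the offset of \<open>u - v\<close> by \<open>b\<close>.\<close>
    have "\<bar>p - q\<bar> \<le> 1"
      using v unfolding cls_def p_def[symmetric] q_def[symmetric] by linarith
    then have "\<bar>p - q\<bar> * b \<le> b" using \<open>b > 0\<close> by simp
    then have "\<bar>p * b - q * b\<bar> \<le> b"
      using \<open>b > 0\<close> by (simp add: abs_mult flip: left_diff_distrib)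
    then have "u - v \<in> half_strip \<beta> b"
      using \<open>b > 0\<close> \<open>fst v \<le> fst u\<close> unfolding p_def q_def
      by (cases u; cases v) (simp add: half_strip_def strip_def right_diff_distrib abs_le_iff)
    then show ?thesis
      using \<open>cls u \<in> J\<close> v_def
      by (intro CollectI exI[of _ v] exI[of _ "u - v"]) simp
  qed
  then show thesis
    using that[of "least ` J"] J_def by blast
qed

text \<open>Finitely many translates of the narrow half strip cover the wide one, and each
  translation costs only the uniform continuity of one map.\<close>

lemma equicontinuous_along_half_strip_width:
  assumes "Z2_tds T" "b > 0" "equicontinuous_along T (half_strip \<beta> b)"
  shows "equicontinuous_along T (half_strip \<beta> B)"
proof -
  obtain F where "finite F" and F: "half_strip \<beta> B \<subseteq> {v + w | v w. v \<in> F \<and> w \<in> half_strip \<beta> b}"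
    using half_strip_cover[OF \<open>b > 0\<close>] .
  have "equicontinuous_along T {v + w | v w. v \<in> F \<and> w \<in> half_strip \<beta> b}"
    using assms(1) equicontinuous_along_finite[OF assms(1) \<open>finite F\<close>] assms(3)
    by (rule equicontinuous_along_sum)
  then show ?thesis
    using F by (rule equicontinuous_along_subset)
qed

section \<open>Returns close to the identity and the backward half strip\<close>

text \<open>Arzela-Ascoli in pigeonhole form: up to a small error, \<open>f j\<close> is determined
  by its values on a finite net \<open>D\<close>, rounded to a finite net \<open>E\<close>.\<close>

lemma equicontinuous_sequence_close_pair:
  fixes f :: "nat \<Rightarrow> 'a::metric_space \<Rightarrow> 'a"
  assumes comp: "compact (UNIV :: 'a set)" and "\<eta> > 0"
    and equi: "\<And>\<epsilon>. \<epsilon> > 0 \<Longrightarrow> \<exists>\<delta>>0. \<forall>x y. dist x y < \<delta> \<longrightarrow> (\<forall>j. dist (f j x) (f j y) < \<epsilon>)"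
  obtains i j where "i < j" "\<And>x. dist (f i x) (f j x) < \<eta>"
proof -
  have "\<eta> / 4 > 0" using \<open>\<eta> > 0\<close> by simp
  then obtain \<delta> where "\<delta> > 0" and \<delta>: "\<And>x y j. dist x y < \<delta> \<Longrightarrow> dist (f j x) (f j y) < \<eta> / 4"
    using equi by metis
  obtain D :: "'a set" where D: "finite D" "\<And>x. \<exists>p\<in>D. dist p x < \<delta>"
    using compact_UNIV_finite_net[OF comp \<open>\<delta> > 0\<close>] by blast
  obtain E :: "'a set" where E: "finite E" "\<And>x. \<exists>p\<in>E. dist p x < \<eta> / 4"
    using compact_UNIV_finite_net[OF comp \<open>\<eta> / 4 > 0\<close>] by blast
  obtain c where c: "\<And>x. c x \<in> E" "\<And>x. dist (c x) x < \<eta> / 4"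
    using E(2) by metis
  \<comment> \<open>Restricting to \<open>D\<close> makes the code \<open>g j\<close> an element of
    the finite set of extensional functions from \<open>D\<close> to \<open>E\<close>.\<close>
  define g where "g j = (\<lambda>p\<in>D. c (f j p))" for j
  have "range g \<subseteq> (D \<rightarrow>\<^sub>E E)" using c(1) by (auto simp: g_def)
  then have "finite (range g)"
    using D(1) E(1) finite_PiE finite_subset by (metis (no_types, lifting))
  then have "\<not> inj g"
    using finite_imageD by blast
  then obtain i j where "i < j" and ij: "g i = g j"
    by (metis injI linorder_neqE_nat)
  have "dist (f i x) (f j x) < \<eta>" for x
  proof -
    obtain p where p: "p \<in> D" "dist p x < \<delta>" using D(2) by blast
    have "c (f i p) = c (f j p)" using fun_cong[OF ij, of p] p(1) by (simp add: g_def)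
    then have "dist (f i p) (f j p) \<le> dist (c (f i p)) (f i p) + dist (c (f j p)) (f j p)"
      by (metis dist_triangle3)
    then show ?thesis
      using c(2)[of "f i p"] c(2)[of "f j p"] \<delta>[OF p(2), of i] \<delta>[OF p(2), of j]
        dist_triangle[of "f i x" "f j x" "f i p"] dist_triangle[of "f i p" "f j x" "f j p"]
      by (simp add: dist_commute)
  qed
  with \<open>i < j\<close> show thesis using that by blast
qed

lemma equicontinuous_along_half_strip_return:
  fixes T :: "int \<times> int \<Rightarrow> 'a::metric_space \<Rightarrow> 'a"
  assumes T: "Z2_tds T" and equi: "equicontinuous_along T (half_strip \<beta> 1)" and "\<eta> > 0"
  obtains u where "u \<in> strip \<beta> 1" "M \<le> fst u" "\<And>z. dist (T u z) z < \<eta>"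
proof -
  define N where "N = max 1 M"
  \<comment> \<open>Rounding down keeps each \<open>w j\<close> within 1 of the line, and the
    difference of two such points is again within 1 of it. The spacing \<open>N\<close> makes first
    coordinates of differences at least \<open>M\<close>.\<close>
  define w where "w j = (int j * N, \<lfloor>\<beta> * of_int (int j * N)\<rfloor>)" for j :: nat
  have "w j \<in> half_strip \<beta> 1" for j
    unfolding w_def half_strip_def strip_def N_def by (auto; linarith)
  then have "\<exists>\<delta>>0. \<forall>x y. dist x y < \<delta> \<longrightarrow> (\<forall>j. dist (T (w j) x) (T (w j) y) < \<epsilon>)"
    if "\<epsilon> > 0" for \<epsilon>
    using equi that unfolding equicontinuous_along_def by meson
  moreover have "compact (UNIV :: 'a set)" using T by (simp add: Z2_tds_def)
  ultimately obtain i j where "i < j" and close: "\<And>x. dist (T (w i) x) (T (w j) x) < \<eta>"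
    using equicontinuous_sequence_close_pair[of \<eta> "\<lambda>j. T (w j)"] \<open>\<eta> > 0\<close> by blast
  show thesis
  proof
    show "w j - w i \<in> strip \<beta> 1"
      unfolding w_def strip_def by (auto simp: right_diff_distrib; linarith)
    have "1 * N \<le> (int j - int i) * N"
      using \<open>i < j\<close> by (intro mult_right_mono) (auto simp: N_def)
    then show "M \<le> fst (w j - w i)"
      by (simp add: w_def N_def left_diff_distrib)
    \<comment> \<open>Closeness of \<open>T (w i)\<close> and \<open>T (w j)\<close> is uniform, so
      it may be evaluated at \<open>T (- w i) z\<close>.\<close>
    show "dist (T (w j - w i) z) z < \<eta>" for z
      using close[of "T (- w i) z"] Z2_tds_add[OF T, of "w i" "- w i" z]
        Z2_tds_add[OF T, of "w j" "- w i" z] Z2_tds_zero[OF T] by (simp add: dist_commute)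
  qed
qed

text \<open>The return \<open>u\<close> depends on \<open>w\<close>, but \<delta> does not: it is
  fixed first, from the forward half strip of width \<open>b + 1\<close>, which contains every
  \<open>u - w\<close> that arises.\<close>

lemma equicontinuous_along_backward_half_strip:
  assumes T: "Z2_tds T" and "b > 0" and equi: "equicontinuous_along T (half_strip \<beta> b)"
  shows "equicontinuous_along T (uminus ` half_strip \<beta> b)"
  unfolding equicontinuous_along_def
proof (intro allI impI)
  fix \<epsilon> :: real assume "\<epsilon> > 0"
  have equi': "equicontinuous_along T (half_strip \<beta> B)" for B
    using equicontinuous_along_half_strip_width[OF T \<open>b > 0\<close> equi] .
  obtain \<delta> where "\<delta> > 0"
    and \<delta>: "\<And>x y w. dist x y < \<delta> \<Longrightarrow> w \<in> half_strip \<beta> (b + 1) \<Longrightarrow> dist (T w x) (T w y) < \<epsilon>"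
    using equi'[of "b + 1"] \<open>\<epsilon> > 0\<close> unfolding equicontinuous_along_def by metis
  have "dist (T (- w) x) (T (- w) y) < \<epsilon>" if w: "w \<in> half_strip \<beta> b" and xy: "dist x y < \<delta> / 3"
    for w x y
  proof -
    obtain u where u: "u \<in> strip \<beta> 1" "fst w \<le> fst u" and close: "\<And>z. dist (T u z) z < \<delta> / 3"
      using equicontinuous_along_half_strip_return[OF T equi'] \<open>\<delta> > 0\<close>
      by (metis divide_pos_pos zero_less_numeral)
    have cancel: "T u (T (- u) z) = z" for z
      using Z2_tds_add[OF T, of u "- u" z] Z2_tds_zero[OF T] by simp
    \<comment> \<open>Uniform closeness of \<open>T u\<close> to the identity passes to its inverse
      by evaluating at \<open>T (- u) z\<close>.\<close>
    have near: "dist z (T (- u) z) < \<delta> / 3" for z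
      using close[of "T (- u) z"] cancel by simp
    have "dist (T (- u) x) (T (- u) y) < \<delta>"
      using near[of x] near[of y] xy dist_triangle[of "T (- u) x" "T (- u) y" x]
        dist_triangle[of x "T (- u) y" y] by (simp add: dist_commute)
    moreover have "u - w \<in> half_strip \<beta> (b + 1)"
      using u w by (cases u; cases w) (auto simp: half_strip_def strip_def algebra_simps)
    ultimately have "dist (T (u - w) (T (- u) x)) (T (u - w) (T (- u) y)) < \<epsilon>"
      by (rule \<delta>)
    moreover have "T (u - w) (T (- u) z) = T (- w) z" for z
      using Z2_tds_add[OF T, of "u - w" "- u" z] by simp
    ultimately show ?thesis by simp
  qed
  then show "\<exists>\<delta>>0. \<forall>x y. dist x y < \<delta> \<longrightarrow>
      (\<forall>w\<in>uminus ` half_strip \<beta> b. dist (T w x) (T w y) < \<epsilon>)"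
    using \<open>\<delta> > 0\<close> by (intro exI[of _ "\<delta> / 3"]) auto
qed

text \<open>The strip is symmetric about the origin.\<close>

lemma strip_eq_half_strips: "strip \<beta> b = half_strip \<beta> b \<union> uminus ` half_strip \<beta> b"
proof -
  have "w \<in> uminus ` half_strip \<beta> b" if "w \<in> strip \<beta> b" "fst w < 0" for w
  proof (rule image_eqI)
    show "- w \<in> half_strip \<beta> b"
      using that by (cases w) (auto simp: half_strip_def strip_def)
  qed simp
  then show ?thesis
    by (force simp: half_strip_def strip_def)
qed

text \<open>Bridges the gap between \<open>max_metric\<close>, which sees only nonnegative first
  coordinates, and equicontinuity along the two-sided strip.\<close>

lemma directional_equicontinuous_iff_half_strip:
  assumes "Z2_tds T" "b > 0"
  shows "directional_equicontinuous T \<beta> b \<longleftrightarrow> equicontinuous_along T (half_strip \<beta> b)"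
proof -
  have "directional_equicontinuous T \<beta> b \<longleftrightarrow> equicontinuous_along T (strip \<beta> b)"
    by (simp add: directional_equicontinuous_def equicontinuous_along_def)
  also have "\<dots> \<longleftrightarrow> equicontinuous_along T (half_strip \<beta> b)"
    unfolding strip_eq_half_strips
    using assms equicontinuous_along_backward_half_strip equicontinuous_along_Un
      equicontinuous_along_subset by (metis Un_upper1)
  finally show ?thesis .
qed

lemma half_strip_eq_Union: "half_strip \<beta> b = (\<Union>k\<in>{1..}. strip_upto \<beta> b k)"
proof -
  have "\<exists>k\<ge>1. m < int k" if "0 \<le> m" for m
    using that by (intro exI[of _ "Suc (nat m)"]) auto
  then show ?thesis
    by (fastforce simp: half_strip_def strip_upto_def)
qed

section \<open>The two equivalences\<close>

lemma strip_upto_mono: "k \<le> l \<Longrightarrow> strip_upto \<beta> b k \<subseteq> strip_upto \<beta> b l"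
  by (auto simp: strip_upto_def)

lemma strip_upto_nonempty: "b > 0 \<Longrightarrow> 1 \<le> k \<Longrightarrow> strip_upto \<beta> b k \<noteq> {}"
  using zero_in_strip_upto[of b k \<beta>] by auto

lemma bounded_complexity_max_metric_iff:
  fixes T :: "int \<times> int \<Rightarrow> 'a::metric_space \<Rightarrow> 'a"
  assumes T: "Z2_tds T" and "b > 0"
  shows "bounded_topological_complexity (max_metric T \<beta> b) \<longleftrightarrow> directional_equicontinuous T \<beta> b"
proof -
  have "compact (UNIV :: 'a set)" using T by (simp add: Z2_tds_def)
  then have "bounded_topological_complexity (max_metric T \<beta> b) \<longleftrightarrow>
    (\<forall>\<epsilon>>0. \<exists>\<delta>>0. \<forall>x y. dist x y < \<delta> \<longrightarrow> (\<forall>k\<ge>1. max_metric T \<beta> b k x y < \<epsilon>))"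
  proof (rule bounded_complexity_Max_iff[OF _ max_metric_def])
    show "continuous_on UNIV (\<lambda>y. dist (T w x) (T w y))" for w x
      by (intro continuous_intros Z2_tds_continuous[OF T])
  qed (use \<open>b > 0\<close> in \<open>auto simp: finite_strip_upto strip_upto_nonempty dist_commute
        dist_triangle dest: subsetD[OF strip_upto_mono]\<close>)
  \<comment> \<open>The initial strips exhaust the half strip, so bounding all the maxima bounds
    every distance along it.\<close>
  moreover have "(\<forall>k\<ge>1. max_metric T \<beta> b k x y < \<epsilon>) \<longleftrightarrow>
      (\<forall>w\<in>half_strip \<beta> b. dist (T w x) (T w y) < \<epsilon>)" for x y \<epsilon>
    using \<open>b > 0\<close> by (auto simp: half_strip_eq_Union max_metric_def finite_strip_upto
        strip_upto_nonempty)
  ultimately show ?thesis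
    by (simp add: directional_equicontinuous_iff_half_strip[OF T \<open>b > 0\<close>]
        equicontinuous_along_def)
qed

text \<open>Both sides speak of the same averages over initial strips, so the general criterion with
  \<open>{1..k}\<close> as index sets suffices, without the backward argument.\<close>

lemma bounded_complexity_mean_metric_iff:
  fixes T :: "int \<times> int \<Rightarrow> 'a::metric_space \<Rightarrow> 'a"
  assumes T: "Z2_tds T"
  shows "bounded_topological_complexity (mean_metric T \<beta> b) \<longleftrightarrow>
    directional_equicontinuous_in_mean T \<beta> b"
proof -
  define \<sigma> where "\<sigma> i x y = (1 / real (card (strip_upto \<beta> b i))) *
      (\<Sum>w\<in>strip_upto \<beta> b i. dist (T w x) (T w y))" for i x y
  have "compact (UNIV :: 'a set)" using T by (simp add: Z2_tds_def)
  then have "bounded_topological_complexity (mean_metric T \<beta> b) \<longleftrightarrow>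
    (\<forall>\<epsilon>>0. \<exists>\<delta>>0. \<forall>x y. dist x y < \<delta> \<longrightarrow> (\<forall>k\<ge>1. mean_metric T \<beta> b k x y < \<epsilon>))"
  proof (rule bounded_complexity_Max_iff[OF _ mean_metric_def[of T \<beta> b], folded \<sigma>_def])
    show "continuous_on UNIV (\<sigma> i x)" for i x
      unfolding \<sigma>_def by (intro continuous_intros Z2_tds_continuous[OF T])
    show "\<sigma> i x z \<le> \<sigma> i x y + \<sigma> i y z" for i x y z
      unfolding \<sigma>_def distrib_left[symmetric] sum.distrib[symmetric]
      by (intro mult_left_mono sum_mono dist_triangle) simp
  qed (auto simp: \<sigma>_def dist_commute)
  also have "\<dots> \<longleftrightarrow> directional_equicontinuous_in_mean T \<beta> b"
    unfolding directional_equicontinuous_in_mean_def by meson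
  finally show ?thesis .
qed

theorem theorem1p1:
  fixes T :: "int \<times> int \<Rightarrow> 'a::metric_space \<Rightarrow> 'a"
    and \<mu> :: "'a measure" and \<beta> :: real
  assumes "Z2_tds T" and "\<mu> \<in> invariant_measures T"
  shows "(\<forall>b>0. bounded_topological_complexity (max_metric T \<beta> b) \<longleftrightarrow>
                directional_equicontinuous T \<beta> b) \<and>
         (\<forall>b>0. bounded_topological_complexity (mean_metric T \<beta> b) \<longleftrightarrow>
                directional_equicontinuous_in_mean T \<beta> b)"
  using bounded_complexity_max_metric_iff[OF assms(1)]
    bounded_complexity_mean_metric_iff[OF assms(1)] by blast

end
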